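(* For every integer $N\ge 1$ and every $\sigma>0$, the partition function $Z_2$ of the space $\mathcal{P}_{\mathbb{C}}(N)$ of positive definite Hermitian $N\times N$ matrices is given by $$Z_2(\sigma)= \frac{\omega_2(N)}{2^{N^2}}\,(2 \pi \sigma^2)^{N/2}\, \exp \Big((N^3-N)\frac{\sigma^2}{6}\Big)\prod_{k=1}^{N-1}\big(1-e^{-k\sigma^2}\big)^{N-k}.$$
   Context: The partition function $Z_2(\sigma)$ is the normalising constant of the Gaussian density proportional to $\exp(-d^2(x,\bar x)/(2\sigma^2))$ on the Riemannian symmetric space $\mathcal{P}_{\mathbb{C}}(N)\cong \mathrm{GL}(N,\mathbb{C})/\mathrm{U}(N)$. Integration in generalized polar coordinates reduces it to the following integral, which is taken as its definition: $$Z_2(\sigma)=\frac{\omega_2(N)}{N!}\int_{\mathbb{R}^N}\prod_{i=1}^N \exp\Big(-\frac{2a_i^2}{\sigma^2}\Big)\prod_{1\le i<j\le N}|\sinh(a_i-a_j)|^2\,da_1\cdots da_N,$$ where $\omega_2(N)>0$ is a constant (a volume factor) depending only on $N$ and not on $\sigma$. *)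

theory Defs
  imports "HOL-Analysis.Analysis"
begin

text \<open>
  The volume factor is an argument \<open>\<omega>\<^sub>2\<close>, a function of the matrix size alone.
  Points \<open>a = (a\<^sub>1, \<dots>, a\<^sub>N)\<close> of Euclidean \<open>N\<close>-space are functions in
  \<open>{1..N} \<rightarrow>\<^sub>E UNIV\<close>, with Lebesgue measure given by the \<open>N\<close>-fold product of \<open>lborel\<close>.
\<close>

definition Z\<^sub>2 :: "(nat \<Rightarrow> real) \<Rightarrow> nat \<Rightarrow> real \<Rightarrow> real" where
  "Z\<^sub>2 \<omega>\<^sub>2 N \<sigma> =
     \<omega>\<^sub>2 N / fact N *
     (LINT a | (\<Pi>\<^sub>M i\<in>{1..N}. lborel).
        (\<Prod>i = 1..N. exp (- (2 * (a i)\<^sup>2 / \<sigma>\<^sup>2))) *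
        (\<Prod>i = 1..N. \<Prod>j \<in> {i<..N}. \<bar>sinh (a i - a j)\<bar>\<^sup>2))"

end

(*
  With x_i = exp(2 a_i), the product of the squares of 2 sinh(a_i - a_j) is a squared Vandermonde
  determinant times a power of each x_i. Expanding both determinants over permutations p, q and
  integrating termwise leaves one-dimensional Gaussian integrals whose values are, up to factors
  independent of p and q, exp(sigma^2 p(i) q(i)). The remaining double sum is N! times the
  Vandermonde determinant at the nodes exp(sigma^2 i), which factors explicitly.
*)

theory Submission
  imports Defs "HOL-Probability.Distributions" "Jordan_Normal_Form.Determinant"
begin

section \<open>Products over pairs of indices\<close>

text \<open>Converts the 1-based pairs in the definition of \<open>Z\<^sub>2\<close> to 0-based
  pairs with the larger index outermost, the shape that suits both Leibniz sums over
  \<open>{0..<n}\<close> and induction on \<open>n\<close>.\<close>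

lemma prod_pairs_triangle_shift:
  fixes f :: "nat \<Rightarrow> nat \<Rightarrow> 'a :: comm_monoid_mult"
  shows "(\<Prod>i = 1..n. \<Prod>j \<in> {i<..n}. f i j) = (\<Prod>i = 0..<n. \<Prod>k = 0..<i. f (Suc k) (Suc i))"
proof -
  have "(\<Prod>i = 1..n. \<Prod>j \<in> {i<..n}. f i j) = (\<Prod>(i, j) \<in> Sigma {1..n} (\<lambda>i. {i<..n}). f i j)"
    by (rule prod.Sigma) auto
  also have "\<dots> = (\<Prod>(i, k) \<in> Sigma {0..<n} (\<lambda>i. {0..<i}). f (Suc k) (Suc i))"
    by (rule prod.reindex_bij_witness[where i = "\<lambda>(i, k). (Suc k, Suc i)"
          and j = "\<lambda>(i, j). (j - 1, i - 1)"]) auto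
  also have "\<dots> = (\<Prod>i = 0..<n. \<Prod>k = 0..<i. f (Suc k) (Suc i))"
    by (rule prod.Sigma[symmetric]) auto
  finally show ?thesis .
qed

text \<open>Every index lies in exactly \<open>n - 1\<close> pairs. In the induction the new row
  \<open>i = n\<close> contributes each old \<open>y k\<close> once and \<open>y n\<close> to the
  power \<open>n\<close>.\<close>

lemma prod_pairs_mult:
  fixes y :: "nat \<Rightarrow> 'a :: comm_monoid_mult"
  shows "(\<Prod>i = 0..<n. \<Prod>k = 0..<i. y k * y i) = (\<Prod>i = 0..<n. y i ^ (n - 1))"
proof (induction n)
  case (Suc n)
  have "(\<Prod>i = 0..<n. y i ^ (n - 1)) * (\<Prod>i = 0..<n. y i) = (\<Prod>i = 0..<n. y i ^ n)"
    unfolding prod.distrib[symmetric]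
    by (intro prod.cong refl) (auto simp flip: power_Suc2)
  then show ?case
    using Suc by (simp add: mult.assoc[symmetric] prod.distrib[of _ "\<lambda>_. y n"])
qed simp

text \<open>Pairs are grouped by their difference: exactly \<open>n - d\<close> of them have
  difference \<open>d\<close>. In the induction the new row \<open>i = n\<close> contributes every
  difference from 1 to \<open>n\<close> once.\<close>

lemma prod_pairs_diff:
  fixes g :: "nat \<Rightarrow> 'a :: comm_monoid_mult"
  shows "(\<Prod>i = 0..<n. \<Prod>k = 0..<i. g (i - k)) = (\<Prod>d = 1..n - 1. g d ^ (n - d))"
proof (induction n)
  case (Suc n)
  have 1: "(\<Prod>k = 0..<n. g (n - k)) = (\<Prod>d = 1..n. g d)"
    by (rule prod.reindex_bij_witness[where i = "\<lambda>d. n - d" and j = "\<lambda>k. n - k"]) auto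
  \<comment> \<open>The range may be extended to \<open>d = n\<close> because the exponent there is
    0.\<close>
  have 2: "(\<Prod>d = 1..n - 1. g d ^ (n - d)) = (\<Prod>d = 1..n. g d ^ (n - d))"
    by (cases n) auto
  have "(\<Prod>d = 1..n. g d ^ (n - d)) * (\<Prod>d = 1..n. g d) = (\<Prod>d = 1..n. g d ^ (Suc n - d))"
    unfolding prod.distrib[symmetric]
    by (intro prod.cong refl) (auto simp: Suc_diff_le simp flip: power_Suc2)
  then show ?case
    using Suc 1 2 by simp
qed simp

section \<open>Vandermonde determinant and the squared sinh product\<close>

text \<open>
  Multiplying \<open>(x\<^sub>i\<^sup>j)\<close> by the unitriangular matrix of coefficients of the Newton
  polynomials \<open>\<Prod>\<^bsub>l<k\<^esub> (X - x\<^sub>l)\<close> makes it lower triangular.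
\<close>

lemma vandermonde_leibniz:
  fixes x :: "nat \<Rightarrow> 'a :: idom"
  shows "(\<Sum>p | p permutes {0..<n}. signof p * (\<Prod>i = 0..<n. x i ^ p i)) =
    (\<Prod>i = 0..<n. \<Prod>k = 0..<i. x i - x k)"
proof -
  define P where "P k = (\<Prod>l = 0..<k. [:- x l, 1:])" for k
  define M where "M = Matrix.mat n n (\<lambda>(i, j). x i ^ j)"
  define R where "R = Matrix.mat n n (\<lambda>(j, k). coeff (P k) j)"
  have M: "M \<in> carrier_mat n n" and R: "R \<in> carrier_mat n n"
    by (auto simp: M_def R_def)
  have degP: "degree (P k) = k" for k
    unfolding P_def by (subst degree_prod_eq_sum_degree) auto
  have lcP: "coeff (P k) k = 1" for k
  proof -
    have "lead_coeff (P k) = 1"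
      unfolding P_def lead_coeff_prod by simp
    then show ?thesis
      by (simp add: degP)
  qed
  have polyP: "poly (P k) z = (\<Prod>l = 0..<k. z - x l)" for k z
    by (simp add: P_def poly_prod)
  \<comment> \<open>Column \<open>k\<close> of \<open>R\<close> lists the coefficients of
    \<open>P k\<close>, so multiplying by \<open>M\<close> evaluates \<open>P k\<close> at the
    nodes. For \<open>i < k\<close> the node \<open>x i\<close> is a root of \<open>P k\<close>,
    which gives the triangular shape used below.\<close>
  have MR: "(M * R) $$ (i, k) = poly (P k) (x i)" if "i < n" "k < n" for i k
  proof -
    have "(M * R) $$ (i, k) = (\<Sum>j = 0..<n. x i ^ j * coeff (P k) j)"
      using that by (simp add: M_def R_def scalar_prod_def)
    also have "\<dots> = (\<Sum>j\<le>k. x i ^ j * coeff (P k) j)"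
      using that degP[of k] by (intro sum.mono_neutral_right) (auto intro: coeff_eq_0)
    also have "\<dots> = poly (P k) (x i)"
      by (simp add: poly_altdef degP mult.commute)
    finally show ?thesis .
  qed
  have detR: "Determinant.det R = 1"
  proof -
    have "upper_triangular R"
      by (auto simp: upper_triangular_def R_def degP intro: coeff_eq_0)
    then show ?thesis
      using det_upper_triangular[OF _ R] by (simp add: prod_list_diag_prod R_def lcP)
  qed
  have "(\<Sum>p | p permutes {0..<n}. signof p * (\<Prod>i = 0..<n. x i ^ p i)) = Determinant.det M"
    unfolding Determinant.det_def'[OF M]
    by (intro sum.cong prod.cong refl arg_cong2[where f = "(*)"])
       (auto simp: M_def dest: permutes_in_image)
  also have "\<dots> = Determinant.det (M * R)"
    using Determinant.det_mult[OF M R] detR by simp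
  also have "\<dots> = prod_list (diag_mat (M * R))"
  proof (rule det_lower_triangular)
    show "(M * R) $$ (i, j) = 0" if "i < j" "j < n" for i j
      using that by (auto simp: MR polyP)
  qed (use M R in auto)
  also have "\<dots> = (\<Prod>i = 0..<n. \<Prod>k = 0..<i. x i - x k)"
    using M R by (auto simp: prod_list_diag_prod MR polyP simp del: index_mult_mat(1) intro!: prod.cong)
  finally show ?thesis .
qed

text \<open>Each squared difference of the nodes \<open>exp (2 * b i)\<close> is
  \<open>4 * x k * x i\<close> times a squared sinh. Over all pairs the factors 4 give the power of
  2 on the left, and the powers \<open>x i ^ (n - 1)\<close> move to the right as the shift by
  \<open>- real (n - 1)\<close> in the exponent.\<close>

lemma prod_sinh_squared_eq_leibniz:
  fixes b :: "nat \<Rightarrow> real"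
  shows "2 ^ (n * (n - 1)) * (\<Prod>i = 0..<n. \<Prod>k = 0..<i. \<bar>sinh (b k - b i)\<bar>\<^sup>2) =
    (\<Sum>p | p permutes {0..<n}. \<Sum>q | q permutes {0..<n}. signof p * signof q *
      (\<Prod>i = 0..<n. exp (2 * (real (p i) + real (q i) - real (n - 1)) * b i)))"
proof -
  define x where "x i = exp (2 * b i)" for i
  \<comment> \<open>The 4 is shared out as \<open>(2 * x k) * (2 * x i)\<close> so that
    \<open>prod_pairs_mult\<close> applies with \<open>2 * x i\<close>.\<close>
  have "(x i - x k)\<^sup>2 = (2 * x k) * (2 * x i) * \<bar>sinh (b k - b i)\<bar>\<^sup>2" for i k
  proof -
    have "x k - x i = 2 * exp (b k + b i) * sinh (b k - b i)"
      by (simp add: x_def sinh_field_def algebra_simps flip: exp_add)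
    moreover have "(exp (b k + b i))\<^sup>2 = x k * x i"
      by (simp add: x_def power2_eq_square flip: exp_add)
    ultimately show ?thesis
      by (simp add: power2_commute[of "x i"] power_mult_distrib)
  qed
  then have "(\<Prod>i = 0..<n. \<Prod>k = 0..<i. x i - x k)\<^sup>2 =
      (\<Prod>i = 0..<n. \<Prod>k = 0..<i. (2 * x k) * (2 * x i)) *
      (\<Prod>i = 0..<n. \<Prod>k = 0..<i. \<bar>sinh (b k - b i)\<bar>\<^sup>2)" (is "_ = _ * ?S")
    by (simp only: prod_power_distrib prod.distrib)
  also have "(\<Prod>i = 0..<n. \<Prod>k = 0..<i. (2 * x k) * (2 * x i)) =
      2 ^ (n * (n - 1)) * (\<Prod>i = 0..<n. x i ^ (n - 1))"
    by (simp only: prod_pairs_mult[of "\<lambda>i. 2 * x i"])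
       (simp add: power_mult_distrib prod.distrib mult.commute flip: power_mult)
  also have "(\<Prod>i = 0..<n. x i ^ (n - 1)) = inverse (\<Prod>i = 0..<n. exp (- (2 * real (n - 1) * b i)))"
    unfolding prod_inversef[symmetric]
    by (intro prod.cong refl) (simp add: x_def exp_minus ac_simps flip: exp_of_nat_mult)
  finally have V: "2 ^ (n * (n - 1)) * ?S =
      (\<Prod>i = 0..<n. \<Prod>k = 0..<i. x i - x k)\<^sup>2 * (\<Prod>i = 0..<n. exp (- (2 * real (n - 1) * b i)))"
    by (simp add: field_simps)
  have "(\<Prod>i = 0..<n. \<Prod>k = 0..<i. x i - x k)\<^sup>2 =
      (\<Sum>p | p permutes {0..<n}. \<Sum>q | q permutes {0..<n}.
        (signof p * (\<Prod>i = 0..<n. x i ^ p i)) * (signof q * (\<Prod>i = 0..<n. x i ^ q i)))"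
    unfolding vandermonde_leibniz[symmetric] power2_eq_square sum_product ..
  moreover have "(\<Prod>i = 0..<n. exp (2 * (real (p i) + real (q i) - real (n - 1)) * b i)) =
      (\<Prod>i = 0..<n. x i ^ p i) * (\<Prod>i = 0..<n. x i ^ q i) *
      (\<Prod>i = 0..<n. exp (- (2 * real (n - 1) * b i)))" for p q
    unfolding prod.distrib[symmetric]
    by (intro prod.cong refl) (simp add: x_def algebra_simps flip: exp_of_nat_mult exp_add)
  ultimately show ?thesis
    unfolding V by (simp only: sum_distrib_left ac_simps)
qed

section \<open>One-dimensional Gaussian integrals\<close>

text \<open>Completing the square turns the integrand into a multiple of the normal density with
  mean \<open>b * \<sigma>\<^sup>2 / 2\<close> and standard deviation \<open>\<sigma> / 2\<close>.
  The form \<open>has_bochner_integral\<close> delivers integrability together with the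
  value.\<close>

lemma gaussian_integral_exp_linear:
  fixes \<sigma> b :: real
  assumes "\<sigma> > 0"
  shows "has_bochner_integral lborel (\<lambda>t. exp (- (2 * t\<^sup>2 / \<sigma>\<^sup>2)) * exp (2 * b * t))
    (sqrt (pi * \<sigma>\<^sup>2 / 2) * exp (\<sigma>\<^sup>2 * b\<^sup>2 / 2))"
proof -
  define \<mu> where "\<mu> = b * \<sigma>\<^sup>2 / 2"
  have "exp (- (2 * t\<^sup>2 / \<sigma>\<^sup>2)) * exp (2 * b * t) =
      sqrt (pi * \<sigma>\<^sup>2 / 2) * exp (\<sigma>\<^sup>2 * b\<^sup>2 / 2) * normal_density \<mu> (\<sigma> / 2) t" for t
  proof -
    have "- (2 * t\<^sup>2 / \<sigma>\<^sup>2) + 2 * b * t = \<sigma>\<^sup>2 * b\<^sup>2 / 2 + - (t - \<mu>)\<^sup>2 / (2 * (\<sigma> / 2)\<^sup>2)"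
      using assms by (simp add: \<mu>_def field_simps power2_eq_square)
    then have "exp (- (2 * t\<^sup>2 / \<sigma>\<^sup>2)) * exp (2 * b * t) =
        exp (\<sigma>\<^sup>2 * b\<^sup>2 / 2) * exp (- (t - \<mu>)\<^sup>2 / (2 * (\<sigma> / 2)\<^sup>2))"
      by (simp only: exp_add[symmetric])
    moreover have "2 * pi * (\<sigma> / 2)\<^sup>2 = pi * \<sigma>\<^sup>2 / 2"
      by (simp add: power_divide)
    moreover have "sqrt (pi * \<sigma>\<^sup>2 / 2) \<noteq> 0"
      using assms by simp
    ultimately show ?thesis
      unfolding normal_density_def by (simp only:) simp
  qed
  moreover have "has_bochner_integral lborel (normal_density \<mu> (\<sigma> / 2)) 1"
    using assms by (auto simp: has_bochner_integral_iff)
  ultimately show ?thesis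
    using has_bochner_integral_mult_right[of "sqrt (pi * \<sigma>\<^sup>2 / 2) * exp (\<sigma>\<^sup>2 * b\<^sup>2 / 2)"]
    by fastforce
qed

section \<open>Double sums over permutations\<close>

text \<open>For fixed \<open>p\<close>, replacing \<open>q\<close> by \<open>q \<circ> p\<close> and
  reindexing the product along \<open>p\<close> cancels both the sign of \<open>p\<close> and its
  occurrence in \<open>h\<close>. The inner sum is thus the same for all \<open>n!\<close>
  permutations \<open>p\<close>.\<close>

lemma sum_signof_twice:
  fixes h :: "nat \<Rightarrow> nat \<Rightarrow> 'a :: {comm_ring_1, semiring_char_0}"
  shows "(\<Sum>p | p permutes {0..<n}. \<Sum>q | q permutes {0..<n}.
      signof p * signof q * (\<Prod>i = 0..<n. h (p i) (q i))) =
    fact n * (\<Sum>q | q permutes {0..<n}. signof q * (\<Prod>i = 0..<n. h i (q i)))"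
proof -
  have "(\<Sum>q | q permutes {0..<n}. signof p * signof q * (\<Prod>i = 0..<n. h (p i) (q i))) =
      (\<Sum>q | q permutes {0..<n}. signof q * (\<Prod>i = 0..<n. h i (q i)))"
    if p: "p permutes {0..<n}" for p
  proof -
    have sp: "(signof p :: 'a) * signof p = 1"
      by (simp add: sign_def)
    have "(\<Sum>q | q permutes {0..<n}. signof p * signof q * (\<Prod>i = 0..<n. h (p i) (q i))) =
      (\<Sum>q | q permutes {0..<n}. signof p * signof (q \<circ> p) * (\<Prod>i = 0..<n. h (p i) ((q \<circ> p) i)))"
      by (rule sum_permutations_compose_right[OF p])
    also have "\<dots> = (\<Sum>q | q permutes {0..<n}. signof q * (\<Prod>i = 0..<n. h i (q i)))"
    proof (intro sum.cong refl)
      fix q assume "q \<in> {q. q permutes {0..<n}}"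
      then have "sign (q \<circ> p) = sign q * sign p"
        using p by (auto intro!: sign_compose intro: permutes_imp_permutation)
      moreover have "(\<Prod>i = 0..<n. h (p i) (q (p i))) = (\<Prod>i = 0..<n. h i (q i))"
        using prod.permute[OF p, of "\<lambda>i. h i (q i)"] by (simp add: o_def)
      ultimately show "signof p * signof (q \<circ> p) * (\<Prod>i = 0..<n. h (p i) ((q \<circ> p) i)) =
          signof q * (\<Prod>i = 0..<n. h i (q i))"
        using sp by (simp add: ac_simps) (metis mult.assoc mult.commute mult_1)
    qed
    finally show ?thesis .
  qed
  then show ?thesis
    by (simp add: card_permutations)
qed

text \<open>When the square is expanded, terms in \<open>p i\<close> alone or \<open>q i\<close>
  alone have sums that are invariant under permutation. Only the cross terms
  \<open>s * p i * q i\<close> depend on how \<open>p\<close> and \<open>q\<close> are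
  paired.\<close>

lemma prod_exp_square_permutes:
  assumes p: "p permutes {0..<n}" and q: "q permutes {0..<n}"
  shows "(\<Prod>i = 0..<n. exp (s * (real (p i) + real (q i) - m)\<^sup>2 / 2)) =
    exp (s * (\<Sum>i = 0..<n. (real i)\<^sup>2 - 2 * m * real i + m\<^sup>2 / 2)) *
    (\<Prod>i = 0..<n. (exp s ^ p i) ^ q i)"
proof -
  \<comment> \<open>\<open>u\<close> collects the terms of half the expanded square that involve
    just one of the two indices.\<close>
  define u where "u i = s * ((real i)\<^sup>2 / 2 - m * real i)" for i
  have up: "(\<Sum>i = 0..<n. u (p i)) = (\<Sum>i = 0..<n. u i)"
    using sum.permute[OF p, of u] by (simp add: o_def)
  have uq: "(\<Sum>i = 0..<n. u (q i)) = (\<Sum>i = 0..<n. u i)"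
    using sum.permute[OF q, of u] by (simp add: o_def)
  have "s * (real (p i) + real (q i) - m)\<^sup>2 / 2 =
      u (p i) + u (q i) + s * m\<^sup>2 / 2 + s * (real (p i) * real (q i))" for i
    by (simp add: u_def power2_eq_square field_simps)
  then have "(\<Sum>i = 0..<n. s * (real (p i) + real (q i) - m)\<^sup>2 / 2) =
      (\<Sum>i = 0..<n. 2 * u i + s * m\<^sup>2 / 2) + (\<Sum>i = 0..<n. s * (real (p i) * real (q i)))"
    by (simp only: sum.distrib up uq mult_2)
  also have "(\<Sum>i = 0..<n. 2 * u i + s * m\<^sup>2 / 2) =
      s * (\<Sum>i = 0..<n. (real i)\<^sup>2 - 2 * m * real i + m\<^sup>2 / 2)"
    unfolding sum_distrib_left by (intro sum.cong refl) (simp add: u_def field_simps)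
  finally have "(\<Prod>i = 0..<n. exp (s * (real (p i) + real (q i) - m)\<^sup>2 / 2)) =
      exp (s * (\<Sum>i = 0..<n. (real i)\<^sup>2 - 2 * m * real i + m\<^sup>2 / 2)) *
      (\<Prod>i = 0..<n. exp (s * (real (p i) * real (q i))))"
    by (simp only: exp_sum[symmetric] exp_add[symmetric] finite_atLeastLessThan)
  moreover have "(exp s ^ p i) ^ q i = exp (s * (real (p i) * real (q i)))" for i
    by (simp add: ac_simps flip: exp_of_nat_mult)
  ultimately show ?thesis
    by simp
qed

lemma sum_square_exponent:
  "(\<Sum>i = 0..<n. (real i)\<^sup>2 - 2 * m * real i + m\<^sup>2 / 2) =
    real n * (real n - 1) * (2 * real n - 1) / 6 - m * real n * (real n - 1) + real n * m\<^sup>2 / 2"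
  by (induction n) (auto simp: field_simps power2_eq_square)

lemma sum_squares_lessThan: "(\<Sum>i = 0..<n. real i * real i) = real n * (real n - 1) * (2 * real n - 1) / 6"
  by (induction n) (auto simp: field_simps)

text \<open>Extracting \<open>exp (s * real i)\<close> from each of the \<open>i\<close> factors of
  row \<open>i\<close> leaves a function of \<open>i - k\<close> alone, to which
  \<open>prod_pairs_diff\<close> applies. The extracted factors add up to a sum of squares in the
  exponent.\<close>

lemma prod_pairs_exp_power_diff:
  fixes s :: real
  shows "(\<Prod>i = 0..<n. \<Prod>k = 0..<i. exp s ^ i - exp s ^ k) =
    exp (s * (real n * (real n - 1) * (2 * real n - 1) / 6)) *
    (\<Prod>d = 1..n - 1. (1 - exp (- (real d * s))) ^ (n - d))"
proof -
  have "exp s ^ i - exp s ^ k = exp (s * real i) * (1 - exp (- (real (i - k) * s)))" if "k < i" for i k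
    using that by (simp add: algebra_simps of_nat_diff flip: exp_of_nat_mult exp_add)
  then have "(\<Prod>i = 0..<n. \<Prod>k = 0..<i. exp s ^ i - exp s ^ k) =
      (\<Prod>i = 0..<n. \<Prod>k = 0..<i. exp (s * real i) * (1 - exp (- (real (i - k) * s))))"
    by (intro prod.cong refl) auto
  also have "\<dots> = (\<Prod>i = 0..<n. exp (s * (real i * real i))) *
      (\<Prod>i = 0..<n. \<Prod>k = 0..<i. 1 - exp (- (real (i - k) * s)))"
    by (simp add: prod.distrib ac_simps flip: exp_of_nat_mult)
  also have "(\<Prod>i = 0..<n. exp (s * (real i * real i))) = exp (s * (\<Sum>i = 0..<n. real i * real i))"
    by (simp add: exp_sum sum_distrib_left)
  also have "(\<Prod>i = 0..<n. \<Prod>k = 0..<i. 1 - exp (- (real (i - k) * s))) =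
      (\<Prod>d = 1..n - 1. (1 - exp (- (real d * s))) ^ (n - d))"
    by (rule prod_pairs_diff)
  finally show ?thesis
    by (simp only: sum_squares_lessThan)
qed

section \<open>Evaluation of the partition integral\<close>

lemma partition_integral:
  fixes \<sigma> :: real
  assumes N: "N \<ge> 1" and \<sigma>: "\<sigma> > 0"
  shows "2 ^ (N * (N - 1)) * (LINT a | (\<Pi>\<^sub>M i\<in>{1..N}. lborel).
        (\<Prod>i = 1..N. exp (- (2 * (a i)\<^sup>2 / \<sigma>\<^sup>2))) *
        (\<Prod>i = 1..N. \<Prod>j \<in> {i<..N}. \<bar>sinh (a i - a j)\<bar>\<^sup>2)) =
    fact N * sqrt (pi * \<sigma>\<^sup>2 / 2) ^ N * exp ((real N ^ 3 - real N) * (\<sigma>\<^sup>2 / 6)) *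
    (\<Prod>k = 1..N - 1. (1 - exp (- (real k * \<sigma>\<^sup>2))) ^ (N - k))" (is "_ * (LINT a | ?M. ?F a) = _")
proof -
  interpret product_sigma_finite "\<lambda>_ :: nat. lborel :: real measure"
    by standard
  \<comment> \<open>The factor of a Leibniz term that depends on coordinate \<open>i\<close> only,
    Gaussian weight included. Coordinates run over \<open>{1..N}\<close> while permutations act on
    \<open>{0..<N}\<close>, hence \<open>i - 1\<close>.\<close>
  define G where "G p q i t = exp (- (2 * t\<^sup>2 / \<sigma>\<^sup>2)) *
    exp (2 * (real (p (i - 1)) + real (q (i - 1)) - real (N - 1)) * t)"
    for p q :: "nat \<Rightarrow> nat" and i t
  have G: "has_bochner_integral lborel (G p q i) (sqrt (pi * \<sigma>\<^sup>2 / 2) *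
      exp (\<sigma>\<^sup>2 * (real (p (i - 1)) + real (q (i - 1)) - real (N - 1))\<^sup>2 / 2))" for p q i
    unfolding G_def by (rule gaussian_integral_exp_linear[OF \<sigma>])
  have intG: "integrable lborel (G p q i)" for p q i
    using G by (auto simp: has_bochner_integral_iff)
  have shift: "(\<Prod>i = 1..N. g i) = (\<Prod>i = 0..<N. g (Suc i))" for g :: "nat \<Rightarrow> real"
    by (rule prod.reindex_bij_witness[where i = Suc and j = "\<lambda>i. i - 1"]) auto
  have "2 ^ (N * (N - 1)) * ?F a = (\<Sum>p | p permutes {0..<N}. \<Sum>q | q permutes {0..<N}.
      signof p * signof q * (\<Prod>i = 1..N. G p q i (a i)))" for a
  proof -
    have "2 ^ (N * (N - 1)) * ?F a = (\<Prod>i = 0..<N. exp (- (2 * (a (Suc i))\<^sup>2 / \<sigma>\<^sup>2))) *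
      (2 ^ (N * (N - 1)) * (\<Prod>i = 0..<N. \<Prod>k = 0..<i. \<bar>sinh (a (Suc k) - a (Suc i))\<bar>\<^sup>2))"
      unfolding prod_pairs_triangle_shift shift by (simp only: ac_simps)
    also have "\<dots> = (\<Sum>p | p permutes {0..<N}. \<Sum>q | q permutes {0..<N}.
      signof p * signof q * (\<Prod>i = 1..N. G p q i (a i)))"
      unfolding prod_sinh_squared_eq_leibniz[of N "\<lambda>i. a (Suc i)"] shift G_def
      by (simp add: sum_distrib_left prod.distrib ac_simps)
    finally show ?thesis .
  qed
  then have "2 ^ (N * (N - 1)) * (LINT a | ?M. ?F a) = (LINT a | ?M.
      (\<Sum>p | p permutes {0..<N}. \<Sum>q | q permutes {0..<N}.
      signof p * signof q * (\<Prod>i = 1..N. G p q i (a i))))"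
    by (simp flip: integral_mult_right_zero)
  \<comment> \<open>Integrating termwise is justified because each term is a product of integrable
    functions of separate coordinates.\<close>
  also have "\<dots> = (\<Sum>p | p permutes {0..<N}. \<Sum>q | q permutes {0..<N}.
      signof p * signof q * (LINT a | ?M. (\<Prod>i = 1..N. G p q i (a i))))"
    by (subst Bochner_Integration.integral_sum Bochner_Integration.integral_sum,
        intro Bochner_Integration.integrable_sum integrable_mult_right
          product_integrable_prod intG finite_atLeastAtMost)+
       simp
  \<comment> \<open>By Fubini each integral factors into one-dimensional ones, whose values
    \<open>G\<close> supplies.\<close>
  also have "\<dots> = (\<Sum>p | p permutes {0..<N}. \<Sum>q | q permutes {0..<N}. signof p * signof q *
      (\<Prod>i = 0..<N. sqrt (pi * \<sigma>\<^sup>2 / 2) *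
        exp (\<sigma>\<^sup>2 * (real (p i) + real (q i) - real (N - 1))\<^sup>2 / 2)))"
    by (simp only: product_integral_prod[OF finite_atLeastAtMost intG]
          has_bochner_integral_integral_eq[OF G]) (simp only: shift diff_Suc_1)
  also have "\<dots> = sqrt (pi * \<sigma>\<^sup>2 / 2) ^ N * (\<Sum>p | p permutes {0..<N}. \<Sum>q | q permutes {0..<N}.
      signof p * signof q *
      (\<Prod>i = 0..<N. exp (\<sigma>\<^sup>2 * (real (p i) + real (q i) - real (N - 1))\<^sup>2 / 2)))"
    by (simp add: prod.distrib sum_distrib_left ac_simps)
  also have "(\<Sum>p | p permutes {0..<N}. \<Sum>q | q permutes {0..<N}. signof p * signof q *
      (\<Prod>i = 0..<N. exp (\<sigma>\<^sup>2 * (real (p i) + real (q i) - real (N - 1))\<^sup>2 / 2))) =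
    exp (\<sigma>\<^sup>2 * (\<Sum>i = 0..<N. (real i)\<^sup>2 - 2 * real (N - 1) * real i + (real (N - 1))\<^sup>2 / 2)) *
    (\<Sum>p | p permutes {0..<N}. \<Sum>q | q permutes {0..<N}. signof p * signof q *
      (\<Prod>i = 0..<N. (exp (\<sigma>\<^sup>2) ^ p i) ^ q i))" (is "_ = ?K * _")
    unfolding sum_distrib_left[of ?K]
    by (intro sum.cong refl) (subst prod_exp_square_permutes, auto)
  \<comment> \<open>After \<open>sum_signof_twice\<close> the remaining sum over \<open>q\<close> is
    a Vandermonde determinant at the nodes \<open>exp (\<sigma>\<^sup>2) ^ i\<close>.\<close>
  also have "(\<Sum>p | p permutes {0..<N}. \<Sum>q | q permutes {0..<N}. signof p * signof q *
      (\<Prod>i = 0..<N. (exp (\<sigma>\<^sup>2) ^ p i) ^ q i)) =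
      fact N * (\<Prod>i = 0..<N. \<Prod>k = 0..<i. exp (\<sigma>\<^sup>2) ^ i - exp (\<sigma>\<^sup>2) ^ k)"
    using sum_signof_twice[where n = N and h = "\<lambda>i j. (exp (\<sigma>\<^sup>2) ^ i) ^ j"]
    by (simp only: vandermonde_leibniz)
  also have "sqrt (pi * \<sigma>\<^sup>2 / 2) ^ N *
      (?K * (fact N * (\<Prod>i = 0..<N. \<Prod>k = 0..<i. exp (\<sigma>\<^sup>2) ^ i - exp (\<sigma>\<^sup>2) ^ k))) =
    fact N * sqrt (pi * \<sigma>\<^sup>2 / 2) ^ N *
    (?K * exp (\<sigma>\<^sup>2 * (real N * (real N - 1) * (2 * real N - 1) / 6))) *
    (\<Prod>k = 1..N - 1. (1 - exp (- (real k * \<sigma>\<^sup>2))) ^ (N - k))"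
    unfolding prod_pairs_exp_power_diff by (simp only: ac_simps)
  \<comment> \<open>With S = N(N-1)(2N-1)/6, the exponent of \<open>?K\<close> is \<sigma>^2 (S -
    N(N-1)^2/2). Adding \<sigma>^2 S gives \<sigma>^2 N(N-1)(N+1)/6.\<close>
  also have "?K * exp (\<sigma>\<^sup>2 * (real N * (real N - 1) * (2 * real N - 1) / 6)) =
      exp ((real N ^ 3 - real N) * (\<sigma>\<^sup>2 / 6))"
    using N unfolding sum_square_exponent exp_add[symmetric]
    by (simp add: of_nat_diff field_simps power2_eq_square power3_eq_cube)
  finally show ?thesis .
qed

theorem proposition3:
  fixes N :: nat and \<sigma> :: real and \<omega>\<^sub>2 :: "nat \<Rightarrow> real"
  assumes "N \<ge> 1" and "\<sigma> > 0" and "\<omega>\<^sub>2 N > 0"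
  shows "Z\<^sub>2 \<omega>\<^sub>2 N \<sigma> =
    \<omega>\<^sub>2 N / 2 ^ (N\<^sup>2) * (2 * pi * \<sigma>\<^sup>2) powr (real N / 2) *
    exp ((real N ^ 3 - real N) * (\<sigma>\<^sup>2 / 6)) *
    (\<Prod>k = 1..N - 1. (1 - exp (- (real k * \<sigma>\<^sup>2))) ^ (N - k))"
proof -
  \<comment> \<open>The power of 2 has two sources: N(N-1) factors from the sinh product, and N more
    from rewriting each Gaussian constant as
    \<open>sqrt (2 * pi * \<sigma>\<^sup>2) / 2\<close>.\<close>
  have "N\<^sup>2 = N * (N - 1) + N"
    using assms(1) by (cases N) (auto simp: power2_eq_square)
  then have two: "(2 :: real) ^ (N\<^sup>2) = 2 ^ (N * (N - 1)) * 2 ^ N"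
    by (simp add: power_add)
  have "sqrt (pi * \<sigma>\<^sup>2 / 2) = sqrt (2 * pi * \<sigma>\<^sup>2) / 2"
    using real_sqrt_divide[of "2 * pi * \<sigma>\<^sup>2" 4] by simp
  moreover have "sqrt (2 * pi * \<sigma>\<^sup>2) ^ N = (2 * pi * \<sigma>\<^sup>2) powr (real N / 2)"
    using assms(2) by (simp add: powr_half_sqrt_powr powr_realpow real_sqrt_power)
  ultimately have c: "sqrt (pi * \<sigma>\<^sup>2 / 2) ^ N = (2 * pi * \<sigma>\<^sup>2) powr (real N / 2) / 2 ^ N"
    by (simp only: power_divide)
  show ?thesis
    using partition_integral[OF assms(1,2)] unfolding Z\<^sub>2_def two c
    by (simp add: field_simps)
qed

end
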